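(* Let $n\in\mathbb N$ and $a\in\mathbb R\setminus(0,1)$. Then $M(H_a(x))(n)=\int_0^1x^nH_a(x)\,dx$ satisfies $$M(H_a(x))(n)=\begin{cases} \frac{-1}{(n+1)^2}\left(1+a^{n+1}(n+1)S_1(\tfrac1a;n)-(a^{n+1}-1)(n+1)S_1(\tfrac1a;\infty)\right),&a\le-1,\\[1mm] \frac{-1}{(n+1)^2}\left(1+a^{n+1}(n+1)S_1(\tfrac1a;n)+(a^{n+1}-1)(n+1)H_a(1)\right),&-1<a<0,\\[1mm] \frac{-1}{(n+1)^2},&a=0,\\[1mm] \frac{1}{(n+1)^2}\left(1+(n+1)S_1(n)\right),&a=1,\\[1mm] \frac{1}{(n+1)^2}\left(1+a^{n+1}(n+1)S_1(\tfrac1a;n)-(a^{n+1}-1)(n+1)S_1(\tfrac1a;\infty)\right),&a>1, \end{cases}$$ where the arising constants are finite.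
   Context: $\mathbb N=\{1,2,\dots\}$. $S_1(b;n)=\sum_{i=1}^n\frac{b^i}{i}$, $S_1(b;\infty)=\lim_{n\to\infty}S_1(b;n)$, and $S_1(n)=S_1(1;n)$. Generalized polylogarithms of weight one: $H_0(x)=\log x$ and, for $a\ne0$, $H_a(x)=\int_0^x\frac{dy}{|a|-\operatorname{sign}(a)\,y}$ (for $0<x<a$ if $a>0$, for $x>0$ if $a<0$). *)

theory Defs
  imports "HOL-Analysis.Analysis"
begin

definition S1 :: "real \<Rightarrow> nat \<Rightarrow> real" where
  "S1 b n = (\<Sum>i=1..n. b ^ i / real i)"

text \<open>Meaningful only if \<open>S1 b\<close> converges.\<close>
definition S1_inf :: "real \<Rightarrow> real" where
  "S1_inf b = lim (S1 b)"

definition H_kernel :: "real \<Rightarrow> real \<Rightarrow> real" where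
  "H_kernel a y = 1 / (\<bar>a\<bar> - sgn a * y)"

text \<open>Intended for \<open>0 < x\<close>, and moreover \<open>x < a\<close> if \<open>a > 0\<close>; on this domain the kernel
  is continuous on \<open>{0..x}\<close>, so the choice of integral does not matter.\<close>
definition H :: "real \<Rightarrow> real \<Rightarrow> real" where
  "H a x = (if a = 0 then ln x else integral {0..x} (H_kernel a))"

text \<open>The interval is open because \<open>H 0\<close> and \<open>H 1\<close> are undefined at the endpoints
  \<open>0\<close> and \<open>1\<close>, respectively.\<close>
definition mellin :: "(real \<Rightarrow> real) \<Rightarrow> nat \<Rightarrow> real" where
  "mellin f n = integral {0<..<1} (\<lambda>x. x ^ n * f x)"

end

(* With L x = ln (1 - x / a) one has H a = - sgn a * L for a \<noteq> 0.  Integrating x ^ n * L x by parts with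
   the antiderivative (x ^ (n + 1) - a ^ (n + 1)) / (n + 1) of x ^ n, instead of x ^ (n + 1) / (n + 1),
   cancels the pole of L' at a: what remains to integrate is a polynomial, and for a = 1 the
   boundary term at 1 vanishes.  Finally S1 (1 / a) tends to - ln (1 - 1 / a). *)

theory Submission
  imports Defs "HOL-Real_Asymp.Real_Asymp"
begin

text \<open>This supplies continuity of the antiderivatives below at an endpoint where the logarithm
  itself is singular.\<close>

lemma continuous_on_x_ln_x: "continuous_on {0..} (\<lambda>x::real. x * ln x)"
proof -
  have "((\<lambda>x::real. x * ln x) \<longlongrightarrow> 0) (at 0 within {0..})"
    using at_within_Ici_at_right[of "0::real"] by (simp, real_asymp)
  moreover have "((\<lambda>x. x * ln x) \<longlongrightarrow> x * ln x) (at x within {0..})" if "x > 0" for x :: real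
    using that by (intro tendsto_intros) auto
  ultimately show ?thesis
    unfolding continuous_on_def by (metis atLeast_iff less_eq_real_def mult_zero_left)
qed

lemma one_minus_divide_pos:
  fixes a x :: real
  assumes "a \<noteq> 0" "0 \<le> x" "a > 0 \<Longrightarrow> x < a"
  shows "0 < 1 - x / a"
  using assms by (cases "a > 0") (auto simp: field_simps)

text \<open>For either sign of \<open>a\<close> the kernel equals \<open>sgn a / (a - y)\<close>,
  and the hypotheses keep \<open>1 - y / a\<close> positive on \<open>{0..x}\<close>.\<close>

lemma H_kernel_has_integral:
  assumes "a \<noteq> 0" "0 \<le> x" "a > 0 \<Longrightarrow> x < a"
  shows "(H_kernel a has_integral - sgn a * ln (1 - x / a)) {0..x}"
proof -
  have "((\<lambda>y. - sgn a * ln (1 - y / a)) has_vector_derivative H_kernel a y) (at y within {0..x})"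
    if y: "y \<in> {0..x}" for y
  proof -
    have pos: "0 < 1 - y / a"
      using assms y by (intro one_minus_divide_pos) auto
    hence "a - y \<noteq> 0"
      using assms by auto
    thus ?thesis
      unfolding has_real_derivative_iff_has_vector_derivative [symmetric] H_kernel_def
      using pos assms
      by (auto intro!: derivative_eq_intros simp: sgn_if abs_if divide_simps split: if_splits)
  qed
  from fundamental_theorem_of_calculus[OF \<open>0 \<le> x\<close> this] show ?thesis
    by simp
qed

lemma H_eq_ln:
  assumes "a \<noteq> 0" "0 \<le> x" "a > 0 \<Longrightarrow> x < a"
  shows "H a x = - sgn a * ln (1 - x / a)"
  using integral_unique[OF H_kernel_has_integral[OF assms]] assms by (simp add: H_def)

text \<open>The argument \<open>1 - x / a\<close> is at most 1 for \<open>a > 0\<close> and at least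
  1 for \<open>a < 0\<close>, so the factor \<open>- sgn a\<close> always corrects the sign of the
  logarithm. This later turns integrability into absolute integrability.\<close>

lemma H_nonneg:
  assumes "a \<noteq> 0" "0 \<le> x" "a > 0 \<Longrightarrow> x < a"
  shows "H a x \<ge> 0"
proof (cases "a > 0")
  case True
  thus ?thesis
    using one_minus_divide_pos[OF assms] assms by (simp add: H_eq_ln)
next
  case False
  thus ?thesis
    using assms by (simp add: H_eq_ln field_simps)
qed

lemma S1_tendsto:
  assumes "\<bar>b\<bar> \<le> 1" "b \<noteq> 1"
  shows "S1 b \<longlonglongrightarrow> - ln (1 - b)"
proof -
  have "(\<lambda>i. b ^ i / real i) sums - ln (1 - b)"
  \<comment> \<open>The point -1 lies on the circle of convergence, where the power series of the
    logarithm is replaced by the alternating harmonic series.\<close>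
  proof (cases "b = -1")
    case True
    have "(\<lambda>i. - ((-1) ^ i / real (Suc i))) sums - ln 2"
      by (intro sums_minus alternating_harmonic_series_sums)
    thus ?thesis
      using True sums_Suc_iff[of "\<lambda>i. b ^ i / real i"] by simp
  next
    case False
    with assms have "\<bar>- b\<bar> < 1" by auto
    from sums_minus[OF ln_series'[OF this]] show ?thesis by simp
  qed
  \<comment> \<open>Summation may start at 0 because the term \<open>b ^ 0 / real 0\<close> is 0 by
    the convention for division by zero.\<close>
  hence "(\<lambda>n. \<Sum>i=0..n. b ^ i / real i) \<longlonglongrightarrow> - ln (1 - b)"
    by (simp add: sums_def')
  moreover have "(\<Sum>i=0..n. b ^ i / real i) = S1 b n" for n
    by (simp add: S1_def sum.atLeast_Suc_atMost)
  ultimately show ?thesis by simp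
qed

text \<open>The case \<open>a = 1\<close> fits the same formula: the logarithm is then taken at 0,
  but its coefficient \<open>a ^ (n + 1) - 1\<close> vanishes.\<close>

lemma power_ln_has_integral:
  fixes a :: real
  assumes "a \<notin> {0..<1}"
  shows "((\<lambda>x. x ^ n * ln (1 - x / a)) has_integral
     - 1 / (real n + 1)\<^sup>2 * (1 + a ^ (n + 1) * (real n + 1) * S1 (1 / a) n
              + (a ^ (n + 1) - 1) * (real n + 1) * ln (1 - 1 / a))) {0<..<1}"
proof -
  have a: "a \<noteq> 0" using assms by auto
  \<comment> \<open>\<open>P\<close> is the polynomial quotient of
    \<open>x ^ Suc n - a ^ Suc n\<close> by \<open>x - a\<close>, \<open>Q\<close> is its
    antiderivative vanishing at 0, and \<open>G\<close> is the antiderivative of the integrand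
    obtained by parts.\<close>
  define P where "P x = (\<Sum>i<Suc n. a ^ (n - i) * x ^ i)" for x
  define Q where "Q x = (\<Sum>i<Suc n. a ^ (n - i) * x ^ Suc i / real (Suc i))" for x
  define G where "G x = ((x ^ Suc n - a ^ Suc n) * ln (1 - x / a) - Q x) / real (Suc n)" for x
  have P: "x ^ Suc n - a ^ Suc n = (x - a) * P x" for x
    using power_diff_sumr2[of x "Suc n" a] by (simp add: P_def)
  have Q': "(Q has_real_derivative P x) (at x)" for x
    unfolding Q_def P_def by (intro DERIV_sum) (auto intro!: derivative_eq_intros simp del: of_nat_Suc power_Suc)
  have nonneg: "0 \<le> 1 - x / a" if "x \<in> {0..1}" for x
    using assms that by (cases "a > 0") (auto simp: field_simps)
  \<comment> \<open>Since \<open>x - a = - a * (1 - x / a)\<close>, the logarithm enters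
    \<open>G\<close> only through t ln t with \<open>t = 1 - x / a\<close>. Hence \<open>G\<close>
    is continuous up to 1 even for \<open>a = 1\<close>.\<close>
  define K where "K x = (1 - x / a) * ln (1 - x / a)" for x
  have "continuous_on {0..1} K"
    unfolding K_def
    by (rule continuous_on_compose2[OF continuous_on_x_ln_x])
       (use nonneg in \<open>auto intro!: continuous_intros simp: a\<close>)
  moreover have "continuous_on {0..1} P" "continuous_on {0..1} Q"
    unfolding P_def Q_def by (intro continuous_intros; simp)+
  ultimately have "continuous_on {0..1} (\<lambda>x. (- a * P x * K x - Q x) / real (Suc n))"
    by (intro continuous_on_divide continuous_on_diff continuous_on_mult continuous_on_const) auto
  moreover have "- a * P x * K x = (x ^ Suc n - a ^ Suc n) * ln (1 - x / a)" for x
    unfolding P K_def using a by (simp add: field_simps)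
  ultimately have "continuous_on {0..1} G"
    by (simp only: G_def [abs_def])
  moreover have "(G has_vector_derivative x ^ n * ln (1 - x / a)) (at x)" if x: "x \<in> {0<..<1}" for x
  proof -
    have pos: "0 < 1 - x / a"
      using assms a x by (intro one_minus_divide_pos) auto
    have "x - a \<noteq> 0"
      using assms x by auto
    have "((\<lambda>x. ln (1 - x / a)) has_real_derivative 1 / (x - a)) (at x)"
      using pos a \<open>x - a \<noteq> 0\<close> by (auto intro!: derivative_eq_intros simp: divide_simps)
    moreover have "((\<lambda>x. x ^ Suc n - a ^ Suc n) has_real_derivative real (Suc n) * x ^ n) (at x)"
      using DERIV_diff[OF DERIV_pow[of "Suc n" x] DERIV_const] by simp
    ultimately have "(G has_real_derivative
        (real (Suc n) * x ^ n * ln (1 - x / a) + 1 / (x - a) * (x ^ Suc n - a ^ Suc n) - P x) / real (Suc n)) (at x)"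
      unfolding G_def [abs_def] by (intro DERIV_cdivide DERIV_diff DERIV_mult Q')
    also have "1 / (x - a) * (x ^ Suc n - a ^ Suc n) = P x"
      unfolding P using \<open>x - a \<noteq> 0\<close> by simp
    finally show ?thesis
      by (simp add: has_real_derivative_iff_has_vector_derivative del: of_nat_Suc)
  qed
  \<comment> \<open>Differentiability is needed only in the interior, which matters for
    \<open>a = 1\<close>, where the logarithm is singular at 1.\<close>
  ultimately have int: "((\<lambda>x. x ^ n * ln (1 - x / a)) has_integral G 1 - G 0) {0..1}"
    by (intro fundamental_theorem_of_calculus_interior) auto
  have G0: "G 0 = 0"
    by (simp add: G_def Q_def)
  \<comment> \<open>The top term \<open>i = n\<close> of \<open>Q 1\<close> gives
    \<open>1 / (real n + 1)\<close>; shifting the index by one in the others gives the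
    \<open>S1\<close> part.\<close>
  have Q1: "Q 1 = a ^ (n + 1) * S1 (1 / a) n + 1 / (real n + 1)"
  proof -
    have "a ^ (n + 1) * S1 (1 / a) n = (\<Sum>i=1..n. a ^ (n + 1 - i) / real i)"
      unfolding S1_def sum_distrib_left
      by (intro sum.cong) (use a in \<open>auto simp: power_diff power_one_over field_simps\<close>)
    also have "\<dots> = (\<Sum>i<n. a ^ (n - i) / real (Suc i))"
      by (rule sum.reindex_bij_witness[of _ Suc "\<lambda>i. i - 1"]) auto
    finally show ?thesis
      by (simp add: Q_def add.commute)
  qed
  \<comment> \<open>The rearrangement of \<open>G 1\<close> is done with free variables, so that
    powers, logarithm and sum stay opaque to the simplifier.\<close>
  have "((a - b) * l - (s + 1 / m)) / m = - 1 / m\<^sup>2 * (1 + s * m + (b - a) * m * l)"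
    if "m > 0" for a b l s m :: real
    using that by (simp add: field_simps power2_eq_square)
  from this[where m = "real n + 1" and a = 1 and b = "a ^ (n + 1)" and l = "ln (1 - 1 / a)"
      and s = "a ^ (n + 1) * S1 (1 / a) n"]
  have G1: "G 1 = - 1 / (real n + 1)\<^sup>2 * (1 + a ^ (n + 1) * (real n + 1) * S1 (1 / a) n
              + (a ^ (n + 1) - 1) * (real n + 1) * ln (1 - 1 / a))"
    unfolding G_def Q1 by (simp add: mult_ac add_ac)
  show ?thesis
    using int unfolding G0 G1 by (simp add: has_integral_Icc_iff_Ioo)
qed

lemma power_ln_has_integral_0:
  "((\<lambda>x. x ^ n * ln x) has_integral - 1 / (real n + 1)\<^sup>2) {0<..<1}"
proof -
  \<comment> \<open>The grouping \<open>x ^ n * (x * ln x)\<close> makes continuity at 0 evident;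
    the form with \<open>x ^ Suc n * ln x\<close> below is the one to differentiate.\<close>
  define G where "G x = x ^ n * (x * ln x) / real (Suc n) - x ^ Suc n / (real (Suc n))\<^sup>2" for x :: real
  have "continuous_on {0..1} G"
    unfolding G_def
    by (intro continuous_intros continuous_on_subset[OF continuous_on_x_ln_x]) auto
  moreover have "(G has_vector_derivative x ^ n * ln x) (at x)" if x: "x \<in> {0<..<1}" for x
  proof -
    have G: "G = (\<lambda>x. x ^ Suc n * ln x / real (Suc n) - x ^ Suc n / (real (Suc n))\<^sup>2)"
      by (auto simp: G_def)
    have d: "((\<lambda>x. x ^ Suc n) has_real_derivative real (Suc n) * x ^ n) (at x)"
      using DERIV_pow[of "Suc n" x] by simp
    have "((\<lambda>x. x ^ Suc n * ln x) has_real_derivative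
        real (Suc n) * x ^ n * ln x + x ^ Suc n * (1 / x)) (at x)"
      using x by (auto intro!: derivative_eq_intros simp del: of_nat_Suc power_Suc)
    from DERIV_diff[OF DERIV_cdivide[OF this] DERIV_cdivide[OF d]]
    have "(G has_real_derivative
        (real (Suc n) * x ^ n * ln x + x ^ Suc n * (1 / x)) / real (Suc n)
          - real (Suc n) * x ^ n / (real (Suc n))\<^sup>2) (at x)"
      unfolding G .
    also have "(real (Suc n) * x ^ n * ln x + x ^ Suc n * (1 / x)) / real (Suc n)
          - real (Suc n) * x ^ n / (real (Suc n))\<^sup>2 = x ^ n * ln x"
      using x by (simp add: power2_eq_square add_divide_distrib del: of_nat_Suc)
    finally show ?thesis
      by (simp add: has_real_derivative_iff_has_vector_derivative)
  qed
  ultimately have "((\<lambda>x. x ^ n * ln x) has_integral G 1 - G 0) {0..1}"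
    by (intro fundamental_theorem_of_calculus_interior) auto
  thus ?thesis
    by (simp add: G_def has_integral_Icc_iff_Ioo add.commute)
qed

lemma power_H_has_integral:
  assumes "a \<notin> {0..<1}"
  shows "((\<lambda>x. x ^ n * H a x) has_integral
     sgn a / (real n + 1)\<^sup>2 * (1 + a ^ (n + 1) * (real n + 1) * S1 (1 / a) n
              + (a ^ (n + 1) - 1) * (real n + 1) * ln (1 - 1 / a))) {0<..<1}"
proof -
  have "x ^ n * H a x = - sgn a * (x ^ n * ln (1 - x / a))" if "x \<in> {0<..<1}" for x
    using assms that by (subst H_eq_ln) auto
  with has_integral_mult_right[OF power_ln_has_integral[OF assms, of n], of "- sgn a"] show ?thesis
    by (subst has_integral_cong) simp_all
qed

text \<open>The integrand has constant sign on the interval: nonpositive for \<open>a = 0\<close>,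
  nonnegative otherwise. Integrability therefore suffices.\<close>

lemma power_H_absolutely_integrable:
  assumes "a \<notin> {0<..<1}"
  shows "(\<lambda>x. x ^ n * H a x) absolutely_integrable_on {0<..<1}"
proof (cases "a = 0")
  case True
  have "(\<lambda>x. - (x ^ n * ln x)) absolutely_integrable_on {0<..<1::real}"
  proof (rule nonnegative_absolutely_integrable_1)
    show "(\<lambda>x. - (x ^ n * ln x)) integrable_on {0<..<1::real}"
      by (intro integrable_neg has_integral_integrable[OF power_ln_has_integral_0])
  qed (auto simp: mult_nonneg_nonpos)
  from absolutely_integrable_scaleR_left[OF this, of "-1"] show ?thesis
    using True by (simp add: H_def)
next
  case False
  with assms have "a \<notin> {0..<1}" by auto
  from has_integral_integrable[OF power_H_has_integral[OF this]] show ?thesis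
    by (rule nonnegative_absolutely_integrable_1)
       (use False assms in \<open>auto intro!: mult_nonneg_nonneg H_nonneg\<close>)
qed

theorem lemma7p3:
  fixes n :: nat and a :: real
  assumes "n \<ge> 1" and "a \<notin> {0<..<1}"
  shows "(\<lambda>x. x ^ n * H a x) absolutely_integrable_on {0<..<1}
    \<and> (a \<le> -1 \<longrightarrow>
         convergent (S1 (1 / a)) \<and>
         mellin (H a) n = - 1 / (real n + 1)\<^sup>2 *
           (1 + a ^ (n + 1) * (real n + 1) * S1 (1 / a) n
              - (a ^ (n + 1) - 1) * (real n + 1) * S1_inf (1 / a)))
    \<and> (-1 < a \<and> a < 0 \<longrightarrow>
         H_kernel a integrable_on {0..1} \<and>
         mellin (H a) n = - 1 / (real n + 1)\<^sup>2 *
           (1 + a ^ (n + 1) * (real n + 1) * S1 (1 / a) n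
              + (a ^ (n + 1) - 1) * (real n + 1) * H a 1))
    \<and> (a = 0 \<longrightarrow>
         mellin (H a) n = - 1 / (real n + 1)\<^sup>2)
    \<and> (a = 1 \<longrightarrow>
         mellin (H a) n = 1 / (real n + 1)\<^sup>2 * (1 + (real n + 1) * S1 1 n))
    \<and> (a > 1 \<longrightarrow>
         convergent (S1 (1 / a)) \<and>
         mellin (H a) n = 1 / (real n + 1)\<^sup>2 *
           (1 + a ^ (n + 1) * (real n + 1) * S1 (1 / a) n
              - (a ^ (n + 1) - 1) * (real n + 1) * S1_inf (1 / a)))"
proof -
  \<comment> \<open>For nonzero \<open>a\<close> the cases differ only in the reading of
    \<open>ln (1 - 1 / a)\<close>: it is \<open>- S1_inf (1 / a)\<close> when the series converges,
    \<open>H a 1\<close> for negative \<open>a\<close>, and it is multiplied by 0 for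
    \<open>a = 1\<close>.\<close>
  note mellin_eq = integral_unique[OF power_H_has_integral, of a n, folded mellin_def]
  have S1_inf: "convergent (S1 (1 / a)) \<and> S1_inf (1 / a) = - ln (1 - 1 / a)" if "a \<le> -1 \<or> a > 1"
  proof -
    have "S1 (1 / a) \<longlonglongrightarrow> - ln (1 - 1 / a)"
      using that by (intro S1_tendsto) (auto simp: field_simps)
    thus ?thesis
      by (auto simp: S1_inf_def convergent_def intro: limI)
  qed
  have mellin_0: "mellin (H 0) n = - 1 / (real n + 1)\<^sup>2"
    using integral_unique[OF power_ln_has_integral_0, of n] by (simp add: mellin_def H_def)
  have kernel: "H_kernel a integrable_on {0..1}" "H a 1 = ln (1 - 1 / a)" if "a < 0"
    using that H_kernel_has_integral[of a 1] H_eq_ln[of a 1] by (auto simp: integrable_on_def)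
  show ?thesis
    using power_H_absolutely_integrable[OF assms(2)] S1_inf mellin_0 kernel mellin_eq
    by (intro conjI impI) simp_all
qed

end
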